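(* Let $\hat\phi_n$ be the convex least squares estimator obtained from the sample $(X_1,Y_1),\ldots,(X_n,Y_n)$. Then: (i) $\sum_{k=1}^n(\psi(X_k)-\hat\phi_n(X_k))(Y_k-\hat\phi_n(X_k))\le0$ for any convex function $\psi$ which is finite on the convex hull $\mathrm{Conv}(X_1,\ldots,X_n)$; (ii) $\sum_{k=1}^n\hat\phi_n(X_k)(Y_k-\hat\phi_n(X_k))=0$; (iii) $\sum_{k=1}^nY_k=\sum_{k=1}^n\hat\phi_n(X_k)$; (iv) the set on which $\hat\phi_n<\infty$ is $\mathrm{Conv}(X_1,\ldots,X_n)$; (v) for any $x\in\mathbb{R}^d$ the map $(X_1,\ldots,X_n,Y_1,\ldots,Y_n)\mapsto\hat\phi_n(x)$ is a Borel-measurable function from $\mathbb{R}^{n(d+1)}$ into $(-\infty,+\infty]$.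
   Context: $\mathfrak{X}\subset\mathbb{R}^d$ ($d\ge1$) is a closed convex set with nonempty interior containing $X_1,\ldots,X_n$ (in (v), where the $X_k$ range over all of $\mathbb{R}^d$, take $\mathfrak{X}=\mathbb{R}^d$), and $Y_1,\ldots,Y_n\in\mathbb{R}$. $\mathcal{K}_{\mathcal{X}}$ is the set of all $z\in\mathbb{R}^n$ for which there is a convex function $\psi:\mathfrak{X}\to\mathbb{R}$ with $\psi(X_j)=z^j$ for all $j=1,\ldots,n$; $Z_n$ is the unique minimizer of $\sum_{k=1}^n|Y_k-z^k|^2$ over $z\in\mathcal{K}_{\mathcal{X}}$. The least squares estimator is $$\hat\phi_n(x)=\inf\Big\{\sum_{k=1}^n\theta^kZ_n^k:\ \sum_{k=1}^n\theta^k=1,\ \sum_{k=1}^n\theta^kX_k=x,\ \theta\ge0,\ \theta\in\mathbb{R}^n\Big\},\quad x\in\mathbb{R}^d,\qquad\inf\emptyset=+\infty.$$ *)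

theory Defs
  imports "HOL-Analysis.Analysis"
begin

text \<open>
  The sample size is the cardinality of the index type \<open>'n\<close> and the dimension that of \<open>'d\<close>.
  The design points \<open>X $ k\<close> need not be distinct.
\<close>

definition convex_values :: "(real^'d) set \<Rightarrow> (real^'d)^'n \<Rightarrow> (real^'n) set" where
  "convex_values D X = {z. \<exists>\<psi> :: real^'d \<Rightarrow> real. convex_on D \<psi> \<and> (\<forall>j. \<psi> (X $ j) = z $ j)}"

definition lse_values :: "(real^'d) set \<Rightarrow> (real^'d)^'n \<Rightarrow> real^'n \<Rightarrow> real^'n" where
  "lse_values D X Y =
     (THE z. is_arg_min (\<lambda>z. \<Sum>k\<in>UNIV. \<bar>Y $ k - z $ k\<bar>\<^sup>2) (\<lambda>z. z \<in> convex_values D X) z)"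

text \<open>The infimum is taken in \<^typ>\<open>ereal\<close>, so it is \<open>\<infinity>\<close> when no weight vector is admissible.\<close>

definition convex_lse :: "(real^'d) set \<Rightarrow> (real^'d)^'n \<Rightarrow> real^'n \<Rightarrow> real^'d \<Rightarrow> ereal" where
  "convex_lse D X Y x =
     Inf {ereal (\<Sum>k\<in>UNIV. \<theta> $ k * lse_values D X Y $ k) | \<theta> :: real^'n.
            (\<Sum>k\<in>UNIV. \<theta> $ k) = 1 \<and> (\<Sum>k\<in>UNIV. \<theta> $ k *\<^sub>R X $ k) = x \<and> (\<forall>k. 0 \<le> \<theta> $ k)}"

end

theory Submission
  imports Defs
begin

text \<open>
  By Farkas' lemma, a vector \<open>z\<close> consists of values of a convex function at the design points iff it
  satisfies Jensen's inequality at every design point, iff it has a subgradient at every design point.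
  Hence \<^const>\<open>convex_values\<close> is a closed convex cone that contains the constants, and does not depend
  on the domain. The least squares values are the projection of \<open>Y\<close> onto this cone, so the first
  three claims are the variational characterization of the projection. For measurability, quantify
  over subgradients instead of convex functions: the distance from \<open>Y\<close> to the cone and then the
  sublevel sets of the estimator are described by projecting closed sets of Euclidean space, and
  such projections are \<open>\<sigma>\<close>-compact.
\<close>

section \<open>Weight vectors and the convex hull of a finite family\<close>

definition weights :: "(real^'n) set" where
  "weights = {\<theta>. (\<Sum>k\<in>UNIV. \<theta> $ k) = 1 \<and> (\<forall>k. 0 \<le> \<theta> $ k)}"

lemma weights_nonneg: "\<theta> \<in> weights \<Longrightarrow> 0 \<le> \<theta> $ k"
  by (simp add: weights_def)

lemma weights_sum: "\<theta> \<in> weights \<Longrightarrow> (\<Sum>k\<in>UNIV. \<theta> $ k) = 1"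
  by (simp add: weights_def)

lemma axis_in_weights: "axis j 1 \<in> weights"
  by (simp add: weights_def axis_def)

lemma sum_axis_scaleR:
  fixes v :: "'n::finite \<Rightarrow> 'a::real_vector"
  shows "(\<Sum>k\<in>UNIV. (axis j 1 :: real^'n) $ k *\<^sub>R v k) = v j"
proof -
  have "(\<Sum>k\<in>UNIV. (axis j 1 :: real^'n) $ k *\<^sub>R v k) = (\<Sum>k\<in>UNIV. if k = j then v k else 0)"
    by (intro sum.cong) (auto simp: axis_def)
  then show ?thesis
    by simp
qed

lemma sum_axis_mult: "(\<Sum>k\<in>UNIV. (axis j 1 :: real^'n) $ k * v k) = v j"
  using sum_axis_scaleR[where v = v] by simp

lemma convex_weights: "convex weights"
  by (auto simp: convex_def weights_def sum.distrib simp flip: sum_distrib_left)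

text \<open>The weights are indexed by \<open>'n\<close> rather than by points, so that
  \<open>v\<close> may repeat values. A linear image of the convex set \<open>weights\<close> is
  convex, and the unit vectors show that it contains every \<open>v j\<close>.\<close>

lemma convex_hull_range_eq_weights:
  fixes v :: "'n::finite \<Rightarrow> 'a::real_vector"
  shows "convex hull range v = (\<lambda>\<theta> :: real^'n. \<Sum>k\<in>UNIV. \<theta> $ k *\<^sub>R v k) ` weights" (is "_ = ?f ` _")
proof
  have "linear ?f"
    by (auto intro!: linearI simp: scaleR_add_left sum.distrib scaleR_sum_right)
  then have "convex (?f ` weights)"
    by (intro convex_linear_image convex_weights)
  moreover have "range v \<subseteq> ?f ` weights"
    using sum_axis_scaleR[where v = v, symmetric] axis_in_weights by (blast intro: image_eqI)
  ultimately show "convex hull range v \<subseteq> ?f ` weights"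
    by (rule hull_minimal[rotated])
  show "?f ` weights \<subseteq> convex hull range v"
    by (auto intro!: convex_sum simp: weights_nonneg weights_sum hull_inc)
qed

section \<open>Subgradients from Jensen's inequality\<close>

text \<open>Farkas: in the cone generated by the increments \<open>(v k - v j, z k - z j)\<close>,
  the vector \<open>(0, -1)\<close> would give weights that average to \<open>v j\<close> but
  violate Jensen's inequality. Otherwise a hyperplane separates it from the cone, and its normal
  yields the slope.\<close>

lemma exists_subgradient:
  fixes v :: "'n::finite \<Rightarrow> 'a::euclidean_space" and z :: "'n \<Rightarrow> real"
  assumes "\<And>\<theta>. \<theta> \<in> weights \<Longrightarrow> (\<Sum>k\<in>UNIV. \<theta> $ k *\<^sub>R v k) = v j \<Longrightarrow> z j \<le> (\<Sum>k\<in>UNIV. \<theta> $ k * z k)"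
  shows "\<exists>\<xi>. \<forall>k. z j + \<xi> \<bullet> (v k - v j) \<le> z k"
proof -
  define w where "w k = (v k - v j, z k - z j)" for k
  let ?C = "convex_cone hull range w"
  have "(0, -1) \<notin> ?C"
  proof
    assume "(0, -1) \<in> ?C"
    then obtain x c where "x \<in> convex hull range w" and c: "0 \<le> c" "(0, -1) = c *\<^sub>R x"
      by (auto simp: convex_cone_hull_convex_hull_nonempty)
    then obtain \<theta> where \<theta>: "\<theta> \<in> weights" and x: "x = (\<Sum>k\<in>UNIV. \<theta> $ k *\<^sub>R w k)"
      unfolding convex_hull_range_eq_weights by blast
    have "c > 0"
      using c by (cases "c = 0") (auto simp: zero_prod_def)
    \<comment> \<open>The weights sum to 1, so the subtracted base point factors out of the average.
      Since \<open>fst x\<close> vanishes, the Jensen hypothesis applies to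
      \<open>\<theta>\<close>.\<close>
    have "fst x = (\<Sum>k\<in>UNIV. \<theta> $ k *\<^sub>R v k) - v j" "snd x = (\<Sum>k\<in>UNIV. \<theta> $ k * z k) - z j"
      using weights_sum[OF \<theta>]
      by (simp_all add: x w_def fst_sum snd_sum algebra_simps sum_subtractf
          flip: scaleR_sum_left sum_distrib_left)
    moreover have "fst x = 0" "c * snd x = -1"
      using c \<open>c > 0\<close> by (simp_all add: prod_eq_iff)
    ultimately have "z j \<le> (\<Sum>k\<in>UNIV. \<theta> $ k * z k)" "c * ((\<Sum>k\<in>UNIV. \<theta> $ k * z k) - z j) = -1"
      using assms[OF \<theta>] by auto
    with \<open>c > 0\<close> show False
      by (smt (verit) mult_nonneg_nonneg)
  qed
  \<comment> \<open>A finitely generated cone is closed, which permits strict separation from a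
    point.\<close>
  then obtain a b where ab: "a \<bullet> (0, -1) < b" "\<And>x. x \<in> ?C \<Longrightarrow> b < a \<bullet> x"
    using separating_hyperplane_closed_point[of ?C "(0, -1)"] closed_convex_cone_hull[of "range w"]
      convex_convex_cone_hull by (metis finite finite_imageI)
  have "b < 0"
    using ab(2)[OF convex_cone_hull_contains_0] by simp
  have nonneg: "0 \<le> a \<bullet> w k" for k
  proof (rule ccontr)
    assume neg: "\<not> 0 \<le> a \<bullet> w k"
    \<comment> \<open>This nonnegative multiple of \<open>w k\<close> has inner product exactly
      \<open>b\<close> with \<open>a\<close>, contradicting the strict bound on the cone.\<close>
    have "(b / (a \<bullet> w k)) *\<^sub>R w k \<in> ?C"
      using neg \<open>b < 0\<close> by (intro convex_cone_hull_mul hull_inc) (auto simp: divide_nonpos_neg)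
    from ab(2)[OF this] neg show False
      by simp
  qed
  obtain p q where a: "a = (p, q)"
    by fastforce
  \<comment> \<open>The inner product of \<open>a\<close> with \<open>(0, -1)\<close> is
    \<open>-q\<close>, which lies below \<open>b < 0\<close>. The separating hyperplane is therefore
    not vertical and can be divided by \<open>q\<close>.\<close>
  have "q > 0"
    using ab(1) \<open>b < 0\<close> by (simp add: a)
  have "z j + (- p /\<^sub>R q) \<bullet> (v k - v j) \<le> z k" for k
    using nonneg[of k] \<open>q > 0\<close> by (simp add: a w_def field_simps)
  then show ?thesis
    by blast
qed

section \<open>Characterizations of the values of convex functions\<close>

lemma convex_values_jensen:
  fixes X :: "(real^'d)^'n"
  assumes "z \<in> convex_values D X" "range (($) X) \<subseteq> D" "\<theta> \<in> weights"
    and "(\<Sum>k\<in>UNIV. \<theta> $ k *\<^sub>R X $ k) = X $ j"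
  shows "z $ j \<le> (\<Sum>k\<in>UNIV. \<theta> $ k * z $ k)"
proof -
  from assms(1) obtain \<psi> where \<psi>: "convex_on D \<psi>" "\<And>j. \<psi> (X $ j) = z $ j"
    by (auto simp: convex_values_def)
  have "\<psi> (\<Sum>k\<in>UNIV. \<theta> $ k *\<^sub>R X $ k) \<le> (\<Sum>k\<in>UNIV. \<theta> $ k * \<psi> (X $ k))"
    using assms \<psi>(1) by (intro convex_on_sum) (auto simp: weights_def)
  then show ?thesis
    by (simp add: assms(4) \<psi>(2))
qed

text \<open>Conversely to the Farkas step, the maximum of the finitely many supporting affine
  functions is convex and interpolates \<open>z\<close>. The right-hand side does not mention
  \<open>D\<close>, so membership transfers between domains.\<close>

lemma convex_values_iff_subgradients:
  fixes X :: "(real^'d)^'n"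
  assumes "convex D" "range (($) X) \<subseteq> D"
  shows "z \<in> convex_values D X \<longleftrightarrow> (\<exists>\<xi> :: (real^'d)^'n. \<forall>j k. z $ j + \<xi> $ j \<bullet> (X $ k - X $ j) \<le> z $ k)"
    (is "_ \<longleftrightarrow> ?sub")
proof
  assume "z \<in> convex_values D X"
  then have "\<exists>\<xi>. \<forall>k. z $ j + \<xi> \<bullet> (X $ k - X $ j) \<le> z $ k" for j
    using assms(2)
    by (intro exists_subgradient[where v = "($) X" and z = "($) z"] convex_values_jensen[of z D])
  then obtain g where "\<And>j k. z $ j + g j \<bullet> (X $ k - X $ j) \<le> z $ k"
    by metis
  then show ?sub
    by (intro exI[of _ "\<chi> j. g j"]) simp
next
  assume ?sub
  then obtain \<xi> :: "(real^'d)^'n" where \<xi>: "\<And>j k. z $ j + \<xi> $ j \<bullet> (X $ k - X $ j) \<le> z $ k"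
    by blast
  define l where "l j x = z $ j + \<xi> $ j \<bullet> (x - X $ j)" for j x
  define \<psi> where "\<psi> x = (MAX j. l j x)" for x
  have le: "l j x \<le> \<psi> x" for j x
    by (simp add: \<psi>_def)
  have "convex_on D \<psi>"
  proof (rule convex_onI)
    fix t x y assume t: "0 < t" "t < (1::real)"
    have "l j ((1 - t) *\<^sub>R x + t *\<^sub>R y) \<le> (1 - t) * \<psi> x + t * \<psi> y" for j
    proof -
      have "l j ((1 - t) *\<^sub>R x + t *\<^sub>R y) = (1 - t) * l j x + t * l j y"
        by (simp add: l_def inner_simps algebra_simps)
      also have "\<dots> \<le> (1 - t) * \<psi> x + t * \<psi> y"
        using t by (intro add_mono mult_left_mono le) auto
      finally show ?thesis .
    qed
    then show "\<psi> ((1 - t) *\<^sub>R x + t *\<^sub>R y) \<le> (1 - t) * \<psi> x + t * \<psi> y"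
      by (subst \<psi>_def) (auto intro!: Max.boundedI)
  qed fact
  moreover have "\<psi> (X $ k) = z $ k" for k
  proof (rule antisym)
    show "\<psi> (X $ k) \<le> z $ k"
      using \<xi> by (auto simp: \<psi>_def l_def)
    show "z $ k \<le> \<psi> (X $ k)"
      using le[of k "X $ k"] by (simp add: l_def)
  qed
  ultimately show "z \<in> convex_values D X"
    by (auto simp: convex_values_def)
qed

text \<open>This form serves closedness: for fixed \<open>X\<close> it is an intersection of closed
  half-spaces in \<open>z\<close>, with no existential quantifier.\<close>

lemma convex_values_iff_weights:
  fixes X :: "(real^'d)^'n"
  assumes "convex D" "range (($) X) \<subseteq> D"
  shows "z \<in> convex_values D X \<longleftrightarrow>
    (\<forall>j. \<forall>\<theta>\<in>weights. (\<Sum>k\<in>UNIV. \<theta> $ k *\<^sub>R X $ k) = X $ j \<longrightarrow> z $ j \<le> (\<Sum>k\<in>UNIV. \<theta> $ k * z $ k))"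
    (is "_ \<longleftrightarrow> ?R")
proof
  assume ?R
  then have "\<exists>\<xi>. \<forall>k. z $ j + \<xi> \<bullet> (X $ k - X $ j) \<le> z $ k" for j
    by (intro exists_subgradient[where v = "($) X" and z = "($) z"]) auto
  then obtain g where "\<And>j k. z $ j + g j \<bullet> (X $ k - X $ j) \<le> z $ k"
    by metis
  then show "z \<in> convex_values D X"
    unfolding convex_values_iff_subgradients[OF assms] by (intro exI[of _ "\<chi> j. g j"]) simp
qed (use convex_values_jensen assms in blast)

section \<open>The closed convex cone\<close>

lemma convex_values_add:
  assumes "z \<in> convex_values D X" "w \<in> convex_values D X"
  shows "z + w \<in> convex_values D X"
proof -
  from assms obtain \<phi> \<psi> where \<phi>: "convex_on D \<phi>" "\<And>j. \<phi> (X $ j) = z $ j"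
    and \<psi>: "convex_on D \<psi>" "\<And>j. \<psi> (X $ j) = w $ j"
    by (auto simp: convex_values_def)
  have "convex_on D (\<lambda>x. \<phi> x + \<psi> x)"
    using \<phi>(1) \<psi>(1) by (rule convex_on_add)
  with \<phi>(2) \<psi>(2) show ?thesis
    by (auto simp: convex_values_def intro!: exI[of _ "\<lambda>x. \<phi> x + \<psi> x"])
qed

lemma convex_values_scaleR:
  assumes "z \<in> convex_values D X" "0 \<le> c"
  shows "c *\<^sub>R z \<in> convex_values D X"
proof -
  from assms(1) obtain \<psi> where \<psi>: "convex_on D \<psi>" "\<And>j. \<psi> (X $ j) = z $ j"
    by (auto simp: convex_values_def)
  have "convex_on D (\<lambda>x. c * \<psi> x)"
    using assms(2) \<psi>(1) by (rule convex_on_cmul)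
  with \<psi>(2) show ?thesis
    by (auto simp: convex_values_def intro!: exI[of _ "\<lambda>x. c * \<psi> x"])
qed

lemma vec_in_convex_values: "convex D \<Longrightarrow> vec c \<in> convex_values D X"
  by (auto simp: convex_values_def intro!: exI[of _ "\<lambda>_. c"] convex_on_const[THEN iffD2])

lemma convex_convex_values: "convex (convex_values D X)"
  by (simp add: convex_def convex_values_add convex_values_scaleR)

lemma closed_convex_values:
  fixes X :: "(real^'d)^'n"
  assumes "convex D" "range (($) X) \<subseteq> D"
  shows "closed (convex_values D X)"
proof -
  have "convex_values D X = {z. \<forall>j. \<forall>\<theta>\<in>weights. (\<Sum>k\<in>UNIV. \<theta> $ k *\<^sub>R X $ k) = X $ j \<longrightarrow>
      z $ j \<le> (\<Sum>k\<in>UNIV. \<theta> $ k * z $ k)}"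
    using convex_values_iff_weights[OF assms] by blast
  then show ?thesis
    unfolding Ball_def
    by (auto intro!: closed_Collect_all closed_Collect_imp closed_Collect_le continuous_intros)
qed

section \<open>Projection onto the cone\<close>

text \<open>The sum of squares is the squared Euclidean distance, and a nonempty closed convex set
  has exactly one closest point, so the \<open>THE\<close> is well defined.\<close>

lemma lse_values_eq_closest_point:
  fixes X :: "(real^'d)^'n"
  assumes "convex D" "range (($) X) \<subseteq> D"
  shows "lse_values D X Y = closest_point (convex_values D X) Y"
proof -
  let ?K = "convex_values D X"
  have K: "convex ?K" "closed ?K" "?K \<noteq> {}"
    using convex_convex_values closed_convex_values[OF assms] vec_in_convex_values[OF assms(1)] by blast+
  have ss: "(\<Sum>k\<in>UNIV. \<bar>Y $ k - z $ k\<bar>\<^sup>2) = (dist Y z)\<^sup>2" for z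
    by (simp add: dist_norm norm_vec_def L2_set_def sum_nonneg)
  show ?thesis
    unfolding lse_values_def ss is_arg_min_linorder
  proof (rule the_equality)
    show "closest_point ?K Y \<in> ?K \<and> (\<forall>y. y \<in> ?K \<longrightarrow> (dist Y (closest_point ?K Y))\<^sup>2 \<le> (dist Y y)\<^sup>2)"
      using closest_point_exists[OF K(2,3)] by (auto intro: power_mono)
  next
    fix z assume "z \<in> ?K \<and> (\<forall>y. y \<in> ?K \<longrightarrow> (dist Y z)\<^sup>2 \<le> (dist Y y)\<^sup>2)"
    then show "z = closest_point ?K Y"
      by (intro closest_point_unique K) (auto simp: abs_le_square_iff[symmetric])
  qed
qed

lemma lse_values_in:
  fixes X :: "(real^'d)^'n"
  assumes "convex D" "range (($) X) \<subseteq> D"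
  shows "lse_values D X Y \<in> convex_values D X"
  unfolding lse_values_eq_closest_point[OF assms]
  using closest_point_in_set closed_convex_values[OF assms] vec_in_convex_values[OF assms(1)] by blast

lemma lse_values_dot:
  fixes X :: "(real^'d)^'n"
  assumes "convex D" "range (($) X) \<subseteq> D" "w \<in> convex_values D X"
  shows "(w - lse_values D X Y) \<bullet> (Y - lse_values D X Y) \<le> 0"
  using closest_point_dot[OF convex_convex_values closed_convex_values assms(3)] assms(1,2)
  by (simp add: lse_values_eq_closest_point inner_commute)

text \<open>The projection plus \<open>w\<close> stays in the cone; testing the variational
  inequality with this sum leaves \<open>w\<close> alone.\<close>

lemma lse_values_cone_dot:
  fixes X :: "(real^'d)^'n"
  assumes "convex D" "range (($) X) \<subseteq> D" "w \<in> convex_values D X"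
  shows "w \<bullet> (Y - lse_values D X Y) \<le> 0"
  using lse_values_dot[OF assms(1,2) convex_values_add[OF assms(3) lse_values_in[OF assms(1,2), of Y]], of Y]
  by simp

text \<open>The two inequalities come from testing with the projection itself and with 0.\<close>

lemma lse_values_orthogonal:
  fixes X :: "(real^'d)^'n"
  assumes "convex D" "range (($) X) \<subseteq> D"
  shows "lse_values D X Y \<bullet> (Y - lse_values D X Y) = 0"
proof (rule antisym)
  show "lse_values D X Y \<bullet> (Y - lse_values D X Y) \<le> 0"
    by (rule lse_values_cone_dot[OF assms lse_values_in[OF assms]])
  show "0 \<le> lse_values D X Y \<bullet> (Y - lse_values D X Y)"
    using lse_values_dot[OF assms vec_in_convex_values[OF assms(1), of 0]] by (simp add: inner_diff_left)
qed

text \<open>The constants 1 and -1 both lie in the cone, so the residuals sum to zero.\<close>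

lemma sum_lse_values:
  fixes X :: "(real^'d)^'n"
  assumes "convex D" "range (($) X) \<subseteq> D"
  shows "(\<Sum>k\<in>UNIV. lse_values D X Y $ k) = (\<Sum>k\<in>UNIV. Y $ k)"
  using lse_values_cone_dot[OF assms vec_in_convex_values[OF assms(1), of 1], of Y]
    lse_values_cone_dot[OF assms vec_in_convex_values[OF assms(1), of "-1"], of Y]
  by (simp add: inner_vec_def sum_subtractf sum_negf)

section \<open>Values and effective domain of the estimator\<close>

lemma convex_lse_alt:
  "convex_lse D X Y x = Inf {ereal (\<Sum>k\<in>UNIV. \<theta> $ k * lse_values D X Y $ k) | \<theta>.
     \<theta> \<in> weights \<and> (\<Sum>k\<in>UNIV. \<theta> $ k *\<^sub>R X $ k) = x}"
  unfolding convex_lse_def weights_def by (rule arg_cong[of _ _ Inf]) auto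

lemma convex_lse_less_iff:
  "convex_lse D X Y x < a \<longleftrightarrow> (\<exists>\<theta>\<in>weights. (\<Sum>k\<in>UNIV. \<theta> $ k *\<^sub>R X $ k) = x \<and>
     ereal (\<Sum>k\<in>UNIV. \<theta> $ k * lse_values D X Y $ k) < a)"
  unfolding convex_lse_alt Inf_less_iff by blast

text \<open>The unit weight vector gives the upper bound; the lower bound is Jensen's inequality for
  the fitted values.\<close>

lemma convex_lse_design:
  fixes X :: "(real^'d)^'n"
  assumes "convex D" "range (($) X) \<subseteq> D"
  shows "convex_lse D X Y (X $ j) = ereal (lse_values D X Y $ j)"
proof (rule antisym)
  show "convex_lse D X Y (X $ j) \<le> ereal (lse_values D X Y $ j)"
    unfolding convex_lse_alt
    by (rule Inf_lower)
      (use axis_in_weights in \<open>auto simp: sum_axis_scaleR sum_axis_mult intro!: exI[of _ "axis j 1"]\<close>)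
  show "ereal (lse_values D X Y $ j) \<le> convex_lse D X Y (X $ j)"
    unfolding convex_lse_alt
    using lse_values_in[OF assms] convex_values_iff_weights[OF assms]
    by (intro Inf_greatest) auto
qed

lemma convex_lse_less_top: "{x. convex_lse D X Y x < \<infinity>} = convex hull range (($) X)"
  unfolding convex_lse_less_iff convex_hull_range_eq_weights by auto

text \<open>Every weighted average is at least the smallest fitted value, and an empty infimum is
  \<infinity>.\<close>

lemma convex_lse_gt_bot:
  fixes X :: "(real^'d)^'n"
  shows "-\<infinity> < convex_lse D X Y x"
proof -
  have "ereal (MIN k. lse_values D X Y $ k) \<le> convex_lse D X Y x"
    unfolding convex_lse_alt
  proof (rule Inf_greatest, clarify)
    fix \<theta> :: "real^'n" assume \<theta>: "\<theta> \<in> weights"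
    have "(MIN k. lse_values D X Y $ k) = (\<Sum>k\<in>UNIV. \<theta> $ k * (MIN k. lse_values D X Y $ k))"
      using weights_sum[OF \<theta>] by (simp flip: sum_distrib_right)
    also have "\<dots> \<le> (\<Sum>k\<in>UNIV. \<theta> $ k * lse_values D X Y $ k)"
      using weights_nonneg[OF \<theta>] by (intro sum_mono mult_left_mono) auto
    finally show "ereal (MIN k. lse_values D X Y $ k) \<le> ereal (\<Sum>k\<in>UNIV. \<theta> $ k * lse_values D X Y $ k)"
      by simp
  qed
  then show ?thesis
    by (rule order_less_le_trans[rotated]) simp
qed

section \<open>Borel measurability\<close>

text \<open>Intersecting with balls writes \<open>F\<close> as a countable union of compact sets,
  whose continuous images are compact.\<close>

lemma fst_image_closed_borel:
  fixes F :: "('a::euclidean_space \<times> 'b::euclidean_space) set"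
  assumes "closed F"
  shows "fst ` F \<in> sets borel"
proof -
  have "F = (\<Union>m::nat. F \<inter> cball 0 (real m))"
    using real_arch_simple by (auto simp: mem_cball dist_norm)
  then have "fst ` F = (\<Union>m::nat. fst ` (F \<inter> cball 0 (real m)))"
    by (metis image_UN)
  moreover have "compact (fst ` (F \<inter> cball 0 (real m)))" for m :: nat
    using assms by (intro compact_continuous_image continuous_intros) (simp add: closed_Int_compact)
  ultimately show ?thesis
    by (simp only:) (intro sets.countable_UN, auto intro: borel_compact)
qed

lemma borel_Collect_ex_closed:
  fixes P :: "'a::euclidean_space \<Rightarrow> 'b::euclidean_space \<Rightarrow> bool"
  assumes "closed {q. P (fst q) (snd q)}"
  shows "{p. \<exists>u. P p u} \<in> sets borel"
proof -
  have "{p. \<exists>u. P p u} = fst ` {q. P (fst q) (snd q)}"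
    by (force simp: image_iff)
  with fst_image_closed_borel[OF assms] show ?thesis
    by simp
qed

lemma dist_lse_values_le:
  fixes X :: "(real^'d)^'n"
  assumes "convex D" "range (($) X) \<subseteq> D" "z \<in> convex_values D X"
  shows "dist Y (lse_values D X Y) \<le> dist Y z"
  using closest_point_le[OF closed_convex_values[OF assms(1,2)] assms(3)]
  by (simp add: lse_values_eq_closest_point[OF assms(1,2)])

text \<open>The minimum is attained, so a bound on it becomes an existential statement over the
  cone, suitable for projection.\<close>

lemma dist_lse_values_le_iff:
  fixes X :: "(real^'d)^'n"
  assumes "convex D" "range (($) X) \<subseteq> D"
  shows "dist Y (lse_values D X Y) \<le> r \<longleftrightarrow> (\<exists>z\<in>convex_values D X. dist Y z \<le> r)"
  using lse_values_in[OF assms, of Y] dist_lse_values_le[OF assms, of _ Y] by (meson order_trans)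

lemma lse_values_eq_iff:
  fixes X :: "(real^'d)^'n"
  assumes "convex D" "range (($) X) \<subseteq> D"
  shows "z = lse_values D X Y \<longleftrightarrow> z \<in> convex_values D X \<and> dist Y z \<le> dist Y (lse_values D X Y)"
proof
  assume z: "z \<in> convex_values D X \<and> dist Y z \<le> dist Y (lse_values D X Y)"
  then have "\<forall>w\<in>convex_values D X. dist Y z \<le> dist Y w"
    using dist_lse_values_le[OF assms] order_trans by blast
  with z show "z = lse_values D X Y"
    unfolding lse_values_eq_closest_point[OF assms]
    by (intro closest_point_unique convex_convex_values closed_convex_values[OF assms]) auto
qed (use lse_values_in[OF assms] in auto)

text \<open>The pairs of a design and a vector in its cone need not form a closed set, since design
  points can merge while their values stay apart. With the subgradients as further coordinates all
  conditions are jointly closed, and projecting these coordinates away leaves a Borel set.\<close>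

lemma dist_lse_values_measurable:
  "(\<lambda>p. dist (snd p) (lse_values UNIV (fst p :: (real^'d)^'n) (snd p))) \<in> borel_measurable borel"
proof (rule borel_measurableI_le)
  fix r :: real
  have "{p. \<exists>u :: (real^'n) \<times> ((real^'d)^'n).
      (\<forall>j k. fst u $ j + snd u $ j \<bullet> (fst p $ k - fst p $ j) \<le> fst u $ k) \<and> dist (snd p) (fst u) \<le> r}
      \<in> sets borel"
    by (intro borel_Collect_ex_closed closed_Collect_conj closed_Collect_all closed_Collect_le continuous_intros)
  also have "{p. \<exists>u :: (real^'n) \<times> ((real^'d)^'n).
      (\<forall>j k. fst u $ j + snd u $ j \<bullet> (fst p $ k - fst p $ j) \<le> fst u $ k) \<and> dist (snd p) (fst u) \<le> r}
    = {p \<in> space borel. dist (snd p) (lse_values UNIV (fst p) (snd p)) \<le> r}"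
    by (auto simp: dist_lse_values_le_iff[OF convex_UNIV subset_UNIV] Bex_def convex_values_iff_subgradients[OF convex_UNIV subset_UNIV])
  finally show "{p \<in> space borel. dist (snd p) (lse_values UNIV (fst p :: (real^'d)^'n) (snd p)) \<le> r} \<in> sets borel" .
qed

lemma convex_lse_measurable:
  "(\<lambda>p. convex_lse UNIV (fst p :: (real^'d)^'n) (snd p) x) \<in> borel_measurable borel"
proof (rule borel_measurableI_less)
  fix a :: ereal
  \<comment> \<open>The weak inequality with a real threshold allows a description by closed
    conditions.\<close>
  define S where "S r = {p :: ((real^'d)^'n) \<times> (real^'n). \<exists>\<theta>\<in>weights. (\<Sum>k\<in>UNIV. \<theta> $ k *\<^sub>R fst p $ k) = x \<and>
      (\<Sum>k\<in>UNIV. \<theta> $ k * lse_values UNIV (fst p) (snd p) $ k) \<le> r}" for r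
  have S: "S r \<in> sets borel" for r
  proof -
    define T where "T p = (p, dist (snd p) (lse_values UNIV (fst p) (snd p)))" for p :: "((real^'d)^'n) \<times> (real^'n)"
    \<comment> \<open>With the distance \<open>d\<close> of \<open>Y\<close> to the cone as an additional coordinate, "\<open>z\<close> is the projection of
      \<open>Y\<close>" becomes the closed condition "\<open>z\<close> is in the cone and \<open>dist Y z \<le> d\<close>".\<close>
    define B where "B = {q :: (((real^'d)^'n) \<times> (real^'n)) \<times> real. \<exists>u :: (real^'n) \<times> ((real^'d)^'n) \<times> (real^'n).
      (\<forall>j k. fst u $ j + fst (snd u) $ j \<bullet> (fst (fst q) $ k - fst (fst q) $ j) \<le> fst u $ k) \<and>
      dist (snd (fst q)) (fst u) \<le> snd q \<and>
      (\<Sum>k\<in>UNIV. snd (snd u) $ k) = 1 \<and> (\<forall>k. 0 \<le> snd (snd u) $ k) \<and>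
      (\<Sum>k\<in>UNIV. snd (snd u) $ k *\<^sub>R fst (fst q) $ k) = x \<and>
      (\<Sum>k\<in>UNIV. snd (snd u) $ k * fst u $ k) \<le> r}"
    have "B \<in> sets borel"
      unfolding B_def
      by (intro borel_Collect_ex_closed closed_Collect_conj closed_Collect_all closed_Collect_le
          closed_Collect_eq continuous_intros)
    moreover have "T \<in> borel_measurable borel"
      unfolding T_def by (intro borel_measurable_Pair dist_lse_values_measurable) simp
    ultimately have "T -` B \<in> sets borel"
      using measurable_sets[of T borel borel B] by simp
    also have "T -` B = S r"
    proof -
      have "p \<in> T -` B \<longleftrightarrow> p \<in> S r" for p
      proof -
        \<comment> \<open>The components of \<open>u\<close> are the candidate \<open>z\<close>, its
          subgradients and the weights.\<close>
        have "p \<in> T -` B \<longleftrightarrow> (\<exists>z \<theta>. z \<in> convex_values UNIV (fst p) \<and>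
            dist (snd p) z \<le> dist (snd p) (lse_values UNIV (fst p) (snd p)) \<and> \<theta> \<in> weights \<and>
            (\<Sum>k\<in>UNIV. \<theta> $ k *\<^sub>R fst p $ k) = x \<and> (\<Sum>k\<in>UNIV. \<theta> $ k * z $ k) \<le> r)"
          unfolding B_def T_def weights_def convex_values_iff_subgradients[OF convex_UNIV subset_UNIV]
          by auto
        also have "\<dots> \<longleftrightarrow> (\<exists>z. z = lse_values UNIV (fst p) (snd p) \<and> (\<exists>\<theta>\<in>weights.
            (\<Sum>k\<in>UNIV. \<theta> $ k *\<^sub>R fst p $ k) = x \<and> (\<Sum>k\<in>UNIV. \<theta> $ k * z $ k) \<le> r))"
          unfolding lse_values_eq_iff[OF convex_UNIV subset_UNIV] by blast
        also have "\<dots> \<longleftrightarrow> p \<in> S r"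
          by (simp add: S_def)
        finally show ?thesis .
      qed
      then show ?thesis
        by blast
    qed
    finally show ?thesis .
  qed
  \<comment> \<open>A rational strictly between an attained value and \<open>a\<close> turns the
    strict sublevel set into a countable union.\<close>
  have "{p \<in> space borel. convex_lse UNIV (fst p :: (real^'d)^'n) (snd p) x < a}
      = (\<Union>r \<in> {r :: rat. ereal (real_of_rat r) < a}. S (real_of_rat r))"
  proof -
    have "convex_lse UNIV X Y x < a \<longleftrightarrow> (\<exists>r. ereal (real_of_rat r) < a \<and> (X, Y) \<in> S (real_of_rat r))"
      for X :: "(real^'d)^'n" and Y
    proof
      assume "convex_lse UNIV X Y x < a"
      then obtain \<theta> where \<theta>: "\<theta> \<in> weights" "(\<Sum>k\<in>UNIV. \<theta> $ k *\<^sub>R X $ k) = x"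
        and "ereal (\<Sum>k\<in>UNIV. \<theta> $ k * lse_values UNIV X Y $ k) < a"
        unfolding convex_lse_less_iff by blast
      then obtain r where "ereal (real_of_rat r) < a"
        and "(\<Sum>k\<in>UNIV. \<theta> $ k * lse_values UNIV X Y $ k) < real_of_rat r"
        using ereal_dense3 by (metis less_ereal.simps(1))
      with \<theta> show "\<exists>r. ereal (real_of_rat r) < a \<and> (X, Y) \<in> S (real_of_rat r)"
        unfolding S_def by (auto intro!: exI[of _ r] bexI[of _ \<theta>])
    next
      assume "\<exists>r. ereal (real_of_rat r) < a \<and> (X, Y) \<in> S (real_of_rat r)"
      then obtain r \<theta> where "ereal (real_of_rat r) < a" and \<theta>: "\<theta> \<in> weights"
        "(\<Sum>k\<in>UNIV. \<theta> $ k *\<^sub>R X $ k) = x"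
        and "(\<Sum>k\<in>UNIV. \<theta> $ k * lse_values UNIV X Y $ k) \<le> real_of_rat r"
        unfolding S_def by auto
      then have "ereal (\<Sum>k\<in>UNIV. \<theta> $ k * lse_values UNIV X Y $ k) < a"
        using ereal_less_eq(3) order_le_less_trans by blast
      with \<theta> show "convex_lse UNIV X Y x < a"
        unfolding convex_lse_less_iff by blast
    qed
    then show ?thesis
      by (simp add: set_eq_iff Bex_def)
  qed
  moreover have "(\<Union>r \<in> {r :: rat. ereal (real_of_rat r) < a}. S (real_of_rat r)) \<in> sets borel"
    using S by (intro sets.countable_UN'') auto
  ultimately show "{p \<in> space borel. convex_lse UNIV (fst p :: (real^'d)^'n) (snd p) x < a} \<in> sets borel"
    by simp
qed

theorem lemma2p4:
  fixes D :: "(real^'d) set" and X :: "(real^'d)^'n" and Y :: "real^'n"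
  assumes "closed D" and "convex D" and "interior D \<noteq> {}" and "range (\<lambda>k. X $ k) \<subseteq> D"
  shows "(\<forall>\<psi> :: real^'d \<Rightarrow> real. convex_on (convex hull range (\<lambda>k. X $ k)) \<psi> \<longrightarrow>
            (\<Sum>k\<in>UNIV. (ereal (\<psi> (X $ k)) - convex_lse D X Y (X $ k)) *
                        (ereal (Y $ k) - convex_lse D X Y (X $ k))) \<le> 0)
       \<and> (\<Sum>k\<in>UNIV. convex_lse D X Y (X $ k) * (ereal (Y $ k) - convex_lse D X Y (X $ k))) = 0
       \<and> ereal (\<Sum>k\<in>UNIV. Y $ k) = (\<Sum>k\<in>UNIV. convex_lse D X Y (X $ k))
       \<and> {x. convex_lse D X Y x < \<infinity>} = convex hull range (\<lambda>k. X $ k)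
       \<and> (\<forall>x :: real^'d.
            (\<lambda>(X' :: (real^'d)^'n, Y' :: real^'n). convex_lse UNIV X' Y' x)
              \<in> borel \<rightarrow>\<^sub>M restrict_space borel {-\<infinity><..})"
proof -
  let ?z = "lse_values D X Y"
  note D = \<open>convex D\<close> \<open>range (\<lambda>k. X $ k) \<subseteq> D\<close>
  have lse: "convex_lse D X Y (X $ k) = ereal (?z $ k)" for k
    by (rule convex_lse_design[OF D])
  have "(\<Sum>k\<in>UNIV. (ereal (\<psi> (X $ k)) - convex_lse D X Y (X $ k)) *
      (ereal (Y $ k) - convex_lse D X Y (X $ k))) \<le> 0"
    if \<psi>: "convex_on (convex hull range (($) X)) \<psi>" for \<psi>
  proof -
    have "(\<chi> k. \<psi> (X $ k)) \<in> convex_values (convex hull range (($) X)) X"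
      using \<psi> by (auto simp: convex_values_def)
    \<comment> \<open>Here \<open>\<psi>\<close> is convex only on the hull; the subgradient
      criterion moves its values to the domain \<open>D\<close>.\<close>
    then have "(\<chi> k. \<psi> (X $ k)) \<in> convex_values D X"
      using D by (simp add: convex_values_iff_subgradients hull_subset)
    from lse_values_dot[OF D this, of Y] show ?thesis
      by (simp add: lse inner_vec_def)
  qed
  moreover have "(\<Sum>k\<in>UNIV. convex_lse D X Y (X $ k) * (ereal (Y $ k) - convex_lse D X Y (X $ k))) = 0"
    using lse_values_orthogonal[OF D, of Y] by (simp add: lse inner_vec_def)
  moreover have "ereal (\<Sum>k\<in>UNIV. Y $ k) = (\<Sum>k\<in>UNIV. convex_lse D X Y (X $ k))"
    by (simp add: lse sum_lse_values[OF D])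
  moreover have "(\<lambda>(X' :: (real^'d)^'n, Y' :: real^'n). convex_lse UNIV X' Y' x)
      \<in> borel \<rightarrow>\<^sub>M restrict_space borel {-\<infinity><..}" for x
    unfolding case_prod_beta
    by (intro measurable_restrict_space2 convex_lse_measurable) (simp add: Pi_iff convex_lse_gt_bot del: ereal_infty_less)
  ultimately show ?thesis
    using convex_lse_less_top by blast
qed

end
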